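(* Assume $\Sigma_n$ and $V_n$ are invertible and let $\widehat{\Omega}$ be any estimator (random symmetric $d\times d$ matrix with positive diagonal entries) of $\Omega_n := \Sigma_n^{-1}V_n\Sigma_n^{-1}$. For any $\eta_n>0$, \[ \sup_{t\ge0}\left|\mathbb{P}\left(\max_{1\le j\le d}\left|\frac{\widehat{\beta}_j - \beta_j}{\sqrt{\widehat{\Omega}_{jj}}}\right| \le t\right) - \mathbb{P}\left(\max_{1\le j\le d}|G_j| \le t\right)\right| \le 2\Delta_n + \mathbb{P}(\mathcal{E}_{\eta_n}^c) + C_n(\eta_n)\eta_n\Phi_{AC} + \frac{d}{n}, \] where $C_n(\eta_n) := 2\kappa_n + 2\kappa_n\eta_n + \sqrt{2\log(2n)}$ with $\kappa_n := \kappa(\Sigma_n^{-1/2}V_n^{1/2})$.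
   Context: Let $(X_1,Y_1),\dots,(X_n,Y_n)$ be random elements of $\mathbb{R}^d\times\mathbb{R}$ (no independence assumed) with finite second moments. Define $\Sigma_n := n^{-1}\sum_i\mathbb{E}[X_iX_i^\top]$, $\Gamma_n := n^{-1}\sum_i\mathbb{E}[X_iY_i]$, $\beta := \Sigma_n^{-1}\Gamma_n$, $\widehat{\Sigma}_n := n^{-1}\sum_i X_iX_i^\top$, $\widehat{\Gamma}_n := n^{-1}\sum_i X_iY_i$, $\widehat\beta := \widehat{\Sigma}_n^{-1}\widehat{\Gamma}_n$, $V_n := \mathrm{Var}(n^{-1}\sum_i X_i(Y_i - X_i^\top\beta))$, $\psi_i := \Sigma_n^{-1}X_i(Y_i-X_i^\top\beta)$ with coordinates $\psi_{ij}$, and $\mathcal{D}_n^{\Sigma} := \|\Sigma_n^{-1/2}\widehat{\Sigma}_n\Sigma_n^{-1/2} - I_d\|_{\mathrm{op}}$. For positive definite $A$, $\|x\|_A:=\sqrt{x^\top Ax}$; $\kappa(A):=\|A^{-1}\|_{\mathrm{op}}\|A\|_{\mathrm{op}}$. For a positive definite matrix $A$, $\mathrm{Corr}(A) := \mathrm{diag}(A)^{-1/2}A\,\mathrm{diag}(A)^{-1/2}$. Let $G=(G_1,\dots,G_d)$ be a centered Gaussian vector with $\mathrm{Var}(G) = \mathrm{Corr}(\Sigma_n^{-1}V_n\Sigma_n^{-1})$. Define \[ \Delta_n := \sup_{t\ge0}\left|\mathbb{P}\left(\max_{j}\left|\frac{n^{-1}\sum_{i=1}^n\psi_{ij}}{\sqrt{(\Omega_n)_{jj}}}\right|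 \le t\right) - \mathbb{P}\left(\max_{j}|G_j| \le t\right)\right|,\qquad \Phi_{AC} := \sup_{t\ge0,\varepsilon>0}\frac{1}{\varepsilon}\mathbb{P}\Big(t \le \max_{j}|G_j| \le t+\varepsilon\Big), \] and the event \[ \mathcal{E}_{\eta_n} := \{\mathcal{D}_n^{\Sigma} \le 1/2\}\cap\Big\{\mathcal{D}_n^{\Sigma}\big\|n^{-1}\textstyle\sum_i\psi_i\big\|_{\Sigma_nV_n^{-1}\Sigma_n} \le \eta_n\Big\}\cap\Big\{\max_{j}\Big|\sqrt{(\Omega_n)_{jj}/\widehat\Omega_{jj}} - 1\Big| \le \eta_n\Big\}. \] *)

theory Defs
  imports "HOL-Probability.Probability"
begin

definition mat_symmetric :: "real^'d^'d \<Rightarrow> bool" where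
  "mat_symmetric A \<longleftrightarrow> transpose A = A"

definition mat_psd :: "real^'d^'d \<Rightarrow> bool" where
  "mat_psd A \<longleftrightarrow> mat_symmetric A \<and> (\<forall>x. 0 \<le> x \<bullet> (A *v x))"

definition mat_sqrt :: "real^'d^'d \<Rightarrow> real^'d^'d" where
  "mat_sqrt A = (THE B. mat_psd B \<and> B ** B = A)"

definition op_norm :: "real^'d^'d \<Rightarrow> real" where
  "op_norm A = onorm (\<lambda>x. A *v x)"

definition cond_num :: "real^'d^'d \<Rightarrow> real" where
  "cond_num A = op_norm (matrix_inv A) * op_norm A"

definition wnorm :: "real^'d^'d \<Rightarrow> real^'d \<Rightarrow> real" where
  "wnorm A x = sqrt (x \<bullet> (A *v x))"

definition corr_mat :: "real^'d^'d \<Rightarrow> real^'d^'d" where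
  "corr_mat A = (\<chi> i j. A $ i $ j / (sqrt (A $ i $ i) * sqrt (A $ j $ j)))"

definition outer :: "real^'d \<Rightarrow> real^'d \<Rightarrow> real^'d^'d" where
  "outer x y = (\<chi> i j. x $ i * y $ j)"

definition vexp :: "'a measure \<Rightarrow> ('a \<Rightarrow> real^'d) \<Rightarrow> real^'d" where
  "vexp M Z = (\<chi> j. integral\<^sup>L M (\<lambda>\<omega>. Z \<omega> $ j))"

definition mexp :: "'a measure \<Rightarrow> ('a \<Rightarrow> real^'d^'d) \<Rightarrow> real^'d^'d" where
  "mexp M Z = (\<chi> j k. integral\<^sup>L M (\<lambda>\<omega>. Z \<omega> $ j $ k))"

definition cov_mat :: "'a measure \<Rightarrow> ('a \<Rightarrow> real^'d) \<Rightarrow> real^'d^'d" where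
  "cov_mat M Z = mexp M (\<lambda>\<omega>. outer (Z \<omega> - vexp M Z) (Z \<omega> - vexp M Z))"

definition centered_gaussian :: "'b measure \<Rightarrow> ('b \<Rightarrow> real^'d) \<Rightarrow> real^'d^'d \<Rightarrow> bool" where
  "centered_gaussian N G C \<longleftrightarrow>
     prob_space N \<and> G \<in> borel_measurable N \<and>
     (\<forall>a. distr N borel (\<lambda>\<omega>. a \<bullet> G \<omega>) =
           (if a \<bullet> (C *v a) = 0 then return borel 0
            else density lborel (normal_density 0 (sqrt (a \<bullet> (C *v a))))))"

end

theory Submission
  imports Defs
begin

text \<open>
  Writing \<open>S\<close> for \<open>\<Sigma>\<close>, \<open>S\<^sub>h\<close> for its empirical version and \<open>z\<close> for the mean of the \<open>\<psi>\<close>'s, the estimation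
  error \<open>p\<close> solves \<open>S\<^sub>h p = S z\<close>. Conjugating by \<open>S\<close> to the power \<open>1/2\<close> turns this into a perturbation
  of the identity of size \<open>D \<le> 1/2\<close>, so that \<open>\<bar>p\<^sub>j - z\<^sub>j\<bar> \<le> 2 \<kappa> \<eta> sqrt \<Omega>\<^sub>j\<^sub>j\<close> on the good event.
  Where moreover the maximum of the normalised \<open>z\<^sub>j\<close> is at most \<open>s = sqrt (2 ln (2 n))\<close>, replacing \<open>\<Omega>\<close> by its estimator
  moves the maximum by at most \<open>C \<eta>\<close> in total; anti-concentration absorbs this shift.
  Exceeding \<open>s\<close> costs \<open>\<Delta>\<close> plus a Gaussian union bound \<open>d / n\<close>.

  The covariance \<open>V\<close> may consist of junk values, because fourth moments are not assumed to exist, and then it need not be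
  positive semidefinite. If \<open>\<eta> \<ge> 1\<close> or the good event is empty, the bound is trivial. Otherwise all
  \<open>\<Omega>\<^sub>j\<^sub>j\<close> are positive, and the existence of the Gaussian vector forces its matrix, hence \<open>V\<close>, to be
  positive semidefinite.
\<close>

section \<open>Spectral theorem for self-adjoint maps and symmetric matrices\<close>

text \<open>A maximiser \<open>v\<close> of \<open>x \<bullet> f x\<close> on the unit sphere of
  \<open>S\<close> is an eigenvector: unless the residual \<open>l *\<^sub>R v - f v\<close>
  vanishes, moving against it would raise the Rayleigh quotient.\<close>

lemma self_adjoint_eigenvector_on_subspace:
  fixes f :: "'a::euclidean_space \<Rightarrow> 'a"
  assumes f: "linear f" and sa: "\<And>x y. f x \<bullet> y = x \<bullet> f y"
    and S: "subspace S" "f ` S \<subseteq> S" "S \<noteq> {0}"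
  obtains v l where "v \<in> S" "norm v = 1" "f v = l *\<^sub>R v"
proof -
  interpret f: linear f by (rule f)
  obtain u where u: "u \<in> S" "u \<noteq> 0"
    using S subspace_0 by blast
  have "compact (S \<inter> sphere 0 1)"
    by (simp add: closed_subspace S closed_Int_compact)
  moreover have "u /\<^sub>R norm u \<in> S \<inter> sphere 0 1"
    using u S by (simp add: subspace_scale)
  moreover have "continuous_on (S \<inter> sphere 0 1) (\<lambda>x. x \<bullet> f x)"
    by (intro continuous_intros linear_continuous_on f linear_conv_bounded_linear[THEN iffD1])
  ultimately obtain v where v: "v \<in> S" "norm v = 1"
    and vmax: "\<And>x. x \<in> S \<Longrightarrow> norm x = 1 \<Longrightarrow> x \<bullet> f x \<le> v \<bullet> f v"
    using continuous_attains_sup[of "S \<inter> sphere 0 1" "\<lambda>x. x \<bullet> f x"] by fastforce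
  define l where "l = v \<bullet> f v"
  have ray: "x \<bullet> f x \<le> l * (x \<bullet> x)" if x: "x \<in> S" for x
  proof (cases "x = 0")
    case False
    have "(x /\<^sub>R norm x) \<bullet> f (x /\<^sub>R norm x) \<le> l"
      unfolding l_def using x S False by (intro vmax) (simp_all add: subspace_scale)
    then show ?thesis
      using False by (simp add: f.scaleR field_simps power2_norm_eq_inner flip: power2_eq_square)
  qed (simp add: f.zero)
  define w where "w = l *\<^sub>R v - f v"
  have w: "w \<in> S"
    using S v by (auto simp: w_def intro!: subspace_diff subspace_scale)
  have vv: "v \<bullet> v = 1" using v by (simp add: dot_square_norm)
  \<comment> \<open>Maximality tested at \<open>v + t *\<^sub>R w\<close>: the coefficient linear in
    \<open>t\<close> is \<open>2 * (w \<bullet> w)\<close>, so the inequality fails for small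
    negative \<open>t\<close> unless \<open>w = 0\<close>.\<close>
  have q: "0 \<le> 2 * t * (w \<bullet> w) + t\<^sup>2 * (l * (w \<bullet> w) - w \<bullet> f w)" for t
  proof -
    have wv: "l * (w \<bullet> v) = w \<bullet> w + w \<bullet> f v"
      by (simp add: w_def inner_diff_right inner_diff_left)
    have vw: "v \<bullet> f w = w \<bullet> f v" by (metis sa inner_commute)
    have "(v + t *\<^sub>R w) \<bullet> f (v + t *\<^sub>R w) \<le> l * ((v + t *\<^sub>R w) \<bullet> (v + t *\<^sub>R w))"
      using v w S by (intro ray) (simp add: subspace_add subspace_scale)
    also have "(v + t *\<^sub>R w) \<bullet> f (v + t *\<^sub>R w) = l + 2 * t * (w \<bullet> f v) + t\<^sup>2 * (w \<bullet> f w)"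
      by (simp add: f.add f.scaleR inner_add_left inner_add_right vw l_def power2_eq_square algebra_simps)
    also have "l * ((v + t *\<^sub>R w) \<bullet> (v + t *\<^sub>R w)) = l + 2 * t * (l * (w \<bullet> v)) + t\<^sup>2 * (l * (w \<bullet> w))"
      by (simp add: inner_add_left inner_add_right vv inner_commute[of v w] power2_eq_square algebra_simps)
    finally show ?thesis unfolding wv by (simp add: algebra_simps)
  qed
  define a where "a = w \<bullet> w"
  define c where "c = l * a - w \<bullet> f w"
  have "c \<ge> 0" using ray[OF w] by (simp add: c_def a_def)
  \<comment> \<open>The choice \<open>t = - (k * a)\<close> turns the quadratic into
    \<open>- (a\<^sup>2 * (k * (1 + k)))\<close>, negative unless \<open>a = 0\<close>. Adding
    \<open>1\<close> to \<open>c\<close> covers \<open>c = 0\<close>.\<close>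
  define k where "k = 1 / (c + 1)"
  have k: "k > 0" "k * c = 1 - k"
    using \<open>c \<ge> 0\<close> by (simp_all add: k_def field_simps)
  have "0 \<le> 2 * (- (k * a)) * a + (- (k * a))\<^sup>2 * c"
    using q[of "- (k * a)"] by (simp add: a_def c_def)
  also have "\<dots> = a\<^sup>2 * k * (k * c - 2)"
    by (simp add: power2_eq_square algebra_simps)
  also have "\<dots> = - (a\<^sup>2 * (k * (1 + k)))"
    unfolding k(2) by (simp add: algebra_simps)
  finally have "a\<^sup>2 * (k * (1 + k)) \<le> 0" by simp
  then have "a = 0"
    using k(1) by (auto simp: mult_le_0_iff)
  then have "f v = l *\<^sub>R v" by (simp add: a_def w_def)
  then show ?thesis using that v by blast
qed

text \<open>Induction on the dimension: split off a unit eigenvector; by self-adjointness its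
  orthogonal complement inside \<open>S\<close> is again invariant, and it is smaller.\<close>

lemma self_adjoint_orthonormal_eigenbasis:
  fixes f :: "'a::euclidean_space \<Rightarrow> 'a"
  assumes f: "linear f" and sa: "\<And>x y. f x \<bullet> y = x \<bullet> f y"
    and S: "subspace S" "f ` S \<subseteq> S"
  shows "\<exists>B. finite B \<and> pairwise orthogonal B \<and> (\<forall>b\<in>B. norm b = 1 \<and> (\<exists>l. f b = l *\<^sub>R b)) \<and> span B = S"
  using S
proof (induction "dim S" arbitrary: S rule: less_induct)
  case less
  show ?case
  proof (cases "S = {0}")
    case True
    then show ?thesis by (intro exI[of _ "{}"]) auto
  next
    case False
    obtain v l where v: "v \<in> S" "norm v = 1" "f v = l *\<^sub>R v"
      using self_adjoint_eigenvector_on_subspace[OF f sa less.prems False] by metis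
    have vv: "v \<bullet> v = 1" using v by (simp add: dot_square_norm)
    define T where "T = {y \<in> S. v \<bullet> y = 0}"
    have T: "subspace T"
      using less.prems(1) by (auto simp: T_def subspace_def inner_add_right)
    have fT: "f ` T \<subseteq> T"
      using less.prems(2) v by (auto simp: T_def simp flip: sa)
    have "v \<notin> T" using vv by (simp add: T_def)
    then have "span T \<subset> span S"
      unfolding span_eq_iff[THEN iffD2, OF T] span_eq_iff[THEN iffD2, OF less.prems(1)]
      using v(1) \<open>v \<notin> T\<close> unfolding T_def by blast
    then have "dim T < dim S" by (rule dim_psubset)
    from less.hyps[OF this T fT] obtain B where B: "finite B" "pairwise orthogonal B"
      "\<forall>b\<in>B. norm b = 1 \<and> (\<exists>l. f b = l *\<^sub>R b)" "span B = T" by blast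
    have BT: "B \<subseteq> T" using B(4) span_superset by blast
    have "span (insert v B) = S"
    proof
      show "span (insert v B) \<subseteq> S"
        using BT v less.prems(1) by (intro span_minimal) (auto simp: T_def)
      show "S \<subseteq> span (insert v B)"
      proof
        fix x assume x: "x \<in> S"
        have "x - (v \<bullet> x) *\<^sub>R v \<in> span B"
          using x v vv less.prems(1)
          by (auto simp: B(4) T_def inner_diff_right intro!: subspace_diff subspace_scale)
        then show "x \<in> span (insert v B)"
          by (auto simp: span_breakdown_eq)
      qed
    qed
    moreover have "pairwise orthogonal (insert v B)"
      using B(2) BT by (auto simp: pairwise_insert orthogonal_def T_def inner_commute)
    ultimately show ?thesis
      using B v by (intro exI[of _ "insert v B"]) auto
  qed
qed

lemma inner_matrix_symmetric:
  fixes A :: "real^'n^'n"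
  assumes "transpose A = A"
  shows "(A *v x) \<bullet> y = x \<bullet> (A *v y)"
  by (metis assms dot_lmul_matrix transpose_matrix_vector)

lemma symmetric_matrixI:
  fixes A :: "real^'n^'n"
  assumes "\<And>x y. (A *v x) \<bullet> y = x \<bullet> (A *v y)"
  shows "transpose A = A"
proof -
  have "x \<bullet> (transpose A *v y) = x \<bullet> (A *v y)" for x y
    by (metis assms dot_lmul_matrix inner_commute transpose_matrix_vector)
  then show ?thesis
    by (metis matrix_eq vector_eq_ldot)
qed

lemma symmetric_matrix_eigenbasis:
  fixes A :: "real^'n^'n"
  assumes "mat_symmetric A"
  obtains B l where "finite B" "pairwise orthogonal B" "span B = UNIV"
    "\<And>b. b \<in> B \<Longrightarrow> norm b = 1" "\<And>b. b \<in> B \<Longrightarrow> A *v b = l b *\<^sub>R b"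
proof -
  have "\<exists>B. finite B \<and> pairwise orthogonal B \<and> (\<forall>b\<in>B. norm b = 1 \<and> (\<exists>l. A *v b = l *\<^sub>R b)) \<and> span B = UNIV"
    using assms by (intro self_adjoint_orthonormal_eigenbasis) (auto simp: mat_symmetric_def inner_matrix_symmetric)
  then show ?thesis
    using that by metis
qed

section \<open>Square roots of positive semidefinite matrices\<close>

text \<open>Replace each eigenvalue by its square root in an orthonormal eigenbasis. Symmetry and
  semidefiniteness are visible from the sum \<open>g\<close>, and \<open>R ** R = A\<close> is
  checked on the basis.\<close>

lemma psd_sqrt_exists:
  fixes A :: "real^'n^'n"
  assumes A: "mat_psd A"
  shows "\<exists>R. mat_psd R \<and> R ** R = A"
proof -
  obtain B l where B: "finite B" "pairwise orthogonal B" "span B = UNIV"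
    "\<And>b. b \<in> B \<Longrightarrow> norm b = 1" "\<And>b. b \<in> B \<Longrightarrow> A *v b = l b *\<^sub>R b"
    using symmetric_matrix_eigenbasis A mat_psd_def by metis
  have bb: "b \<bullet> c = (if b = c then 1 else 0)" if "b \<in> B" "c \<in> B" for b c
    using B(2,4) that by (auto simp: pairwise_def orthogonal_def dot_square_norm)
  have l: "l b \<ge> 0" if "b \<in> B" for b
    using A B(5)[OF that] bb[OF that that] unfolding mat_psd_def by (metis inner_scaleR_right mult.right_neutral)
  define g where "g x = (\<Sum>b\<in>B. (sqrt (l b) * (x \<bullet> b)) *\<^sub>R b)" for x
  have lg: "linear g"
    by (rule linearI) (simp_all add: g_def inner_add_left algebra_simps sum.distrib scaleR_sum_right)
  have gb: "g c = sqrt (l c) *\<^sub>R c" if c: "c \<in> B" for c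
  proof -
    have "g c = (\<Sum>b\<in>B. if b = c then sqrt (l c) *\<^sub>R c else 0)"
      unfolding g_def by (rule sum.cong) (auto simp: bb c)
    then show ?thesis using B(1) c by simp
  qed
  define R where "R = matrix g"
  have R: "R *v x = g x" for x
    by (simp add: R_def matrix_works lg)
  have "(A *v x) = (R ** R) *v x" for x
  proof -
    have "linear (\<lambda>x. A *v x)" "linear (\<lambda>x. (R ** R) *v x)" by simp_all
    moreover have "A *v b = (R ** R) *v b" if "b \<in> B" for b
      using that l[OF that]
      by (simp add: B(5) R gb linear_scale[OF lg] flip: matrix_vector_mul_assoc)
    ultimately show ?thesis
      using linear_eq_on_span[of _ _ B x] B(3) by blast
  qed
  moreover have "transpose R = R"
  proof (rule symmetric_matrixI)
    show "(R *v x) \<bullet> y = x \<bullet> (R *v y)" for x y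
      by (simp add: R g_def inner_sum_left inner_sum_right inner_commute mult_ac)
  qed
  moreover have "0 \<le> x \<bullet> (R *v x)" for x
    unfolding R g_def inner_sum_right using l by (auto intro!: sum_nonneg simp: mult.assoc)
  ultimately show ?thesis
    by (intro exI[of _ R]) (simp add: mat_psd_def mat_symmetric_def matrix_eq)
qed

text \<open>Agreement on an eigenbasis of \<open>R\<close> suffices. Since
  \<open>(Q + l b) (Q - l b) b = 0\<close>, the defect \<open>w\<close> lies in the eigenspace of
  \<open>Q\<close> for \<open>- l b\<close>, which semidefiniteness makes trivial when
  \<open>l b > 0\<close>.\<close>

lemma psd_sqrt_unique:
  fixes R Q :: "real^'n^'n"
  assumes R: "mat_psd R" and Q: "mat_psd Q" and eq: "R ** R = Q ** Q"
  shows "R = Q"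
proof -
  obtain B l where B: "finite B" "pairwise orthogonal B" "span B = UNIV"
    "\<And>b. b \<in> B \<Longrightarrow> norm b = 1" "\<And>b. b \<in> B \<Longrightarrow> R *v b = l b *\<^sub>R b"
    using symmetric_matrix_eigenbasis R mat_psd_def by metis
  have "R *v b = Q *v b" if b: "b \<in> B" for b
  proof -
    have bb: "b \<bullet> b = 1" using B(4)[OF b] by (simp add: dot_square_norm)
    have l: "l b \<ge> 0"
      using R B(5)[OF b] bb unfolding mat_psd_def by (metis inner_scaleR_right mult.right_neutral)
    define w where "w = Q *v b - l b *\<^sub>R b"
    have QQ: "Q *v (Q *v b) = (l b * l b) *\<^sub>R b"
      using B(5)[OF b] eq by (metis matrix_vector_mul_assoc matrix_vector_mult_scaleR scaleR_scaleR)
    have "Q *v w = - (l b *\<^sub>R w)"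
      by (simp add: w_def QQ algebra_simps)
    then have "w \<bullet> (Q *v w) = - (l b * (w \<bullet> w))"
      by simp
    moreover have "0 \<le> w \<bullet> (Q *v w)" using Q by (simp add: mat_psd_def)
    moreover have "0 \<le> l b * (w \<bullet> w)" using l by simp
    ultimately have lw: "l b * (w \<bullet> w) = 0" by simp
    have "w = 0"
    proof (cases "l b = 0")
      \<comment> \<open>For eigenvalue zero, symmetry of \<open>Q\<close> gives
        \<open>w \<bullet> w = b \<bullet> Q (Q b) = 0\<close> instead.\<close>
      case True
      then have "w \<bullet> w = b \<bullet> (Q *v (Q *v b))"
        using Q by (simp add: w_def mat_psd_def mat_symmetric_def inner_matrix_symmetric)
      then show ?thesis using QQ True by simp
    qed (use lw in simp)
    then show ?thesis by (simp add: w_def B(5)[OF b])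
  qed
  then have "R *v x = Q *v x" for x
    using linear_eq_on_span[of "(*v) R" "(*v) Q" B x] B(3) by simp
  then show ?thesis by (simp add: matrix_eq)
qed

lemma mat_sqrt:
  assumes "mat_psd A"
  shows mat_psd_mat_sqrt: "mat_psd (mat_sqrt A)"
    and mat_sqrt_square: "mat_sqrt A ** mat_sqrt A = A"
proof -
  have "\<exists>!R. mat_psd R \<and> R ** R = A"
    using psd_sqrt_exists[OF assms] psd_sqrt_unique by metis
  then have "mat_psd (mat_sqrt A) \<and> mat_sqrt A ** mat_sqrt A = A"
    unfolding mat_sqrt_def by (rule theI')
  then show "mat_psd (mat_sqrt A)" "mat_sqrt A ** mat_sqrt A = A" by auto
qed

section \<open>Inverses, operator norms and the deterministic error bound\<close>

lemma matrix_inv_mult: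
  fixes A :: "real^'n^'n"
  assumes "invertible A"
  shows "A ** matrix_inv A = mat 1" "matrix_inv A ** A = mat 1"
  using someI_ex[OF assms[unfolded invertible_def]] by (simp_all add: matrix_inv_def)

lemma matrix_inv_mult_vector:
  fixes A :: "real^'n^'n"
  assumes "invertible A"
  shows "A *v (matrix_inv A *v x) = x" "matrix_inv A *v (A *v x) = x"
  by (simp_all add: matrix_vector_mul_assoc matrix_inv_mult[OF assms])

lemma mat_psd_matrix_inv:
  fixes A :: "real^'n^'n"
  assumes A: "mat_psd A" "invertible A"
  shows "mat_psd (matrix_inv A)"
proof -
  have sym: "(A *v x) \<bullet> y = x \<bullet> (A *v y)" for x y
    using A(1) by (simp add: mat_psd_def mat_symmetric_def inner_matrix_symmetric)
  have "(matrix_inv A *v x) \<bullet> y = x \<bullet> (matrix_inv A *v y)" for x y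
    using sym[of "matrix_inv A *v x" "matrix_inv A *v y"] by (simp add: matrix_inv_mult_vector[OF A(2)])
  moreover have "0 \<le> x \<bullet> (matrix_inv A *v x)" for x
    using A(1) matrix_inv_mult_vector(1)[OF A(2), of x]
    unfolding mat_psd_def by (metis inner_commute)
  ultimately show ?thesis
    by (simp add: mat_psd_def mat_symmetric_def symmetric_matrixI)
qed

lemma norm_matrix_vector_le: "norm (A *v x) \<le> op_norm A * norm x"
  unfolding op_norm_def by (rule onorm) simp

lemma op_norm_nonneg: "0 \<le> op_norm A"
  unfolding op_norm_def by (rule onorm_pos_le) simp

text \<open>Cauchy-Schwarz applied to the squared left-hand side
  \<open>x \<bullet> (A *v (transpose A *v x))\<close>, after which one factor
  \<open>norm (transpose A *v x)\<close> cancels.\<close>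

lemma op_norm_transpose_le:
  fixes A :: "real^'n^'n"
  shows "norm (transpose A *v x) \<le> op_norm A * norm x"
proof -
  have "(norm (transpose A *v x))\<^sup>2 = x \<bullet> (A *v (transpose A *v x))"
    by (metis dot_lmul_matrix power2_norm_eq_inner transpose_matrix_vector)
  also have "\<dots> \<le> norm x * (op_norm A * norm (transpose A *v x))"
    by (rule order_trans[OF norm_cauchy_schwarz mult_left_mono[OF norm_matrix_vector_le]]) simp
  finally have *: "norm (transpose A *v x) * norm (transpose A *v x) \<le> (op_norm A * norm x) * norm (transpose A *v x)"
    by (simp add: power2_eq_square mult_ac)
  show ?thesis
  proof (cases "norm (transpose A *v x) = 0")
    case True
    show ?thesis using True by (simp add: op_norm_nonneg)
  next
    case False
    then have "0 < norm (transpose A *v x)" by simp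
    with * show ?thesis by (rule mult_right_le_imp_le)
  qed
qed

lemma invertible_of_square:
  fixes R :: "real^'n^'n"
  assumes "invertible (R ** R)"
  shows "invertible R"
  using assms by (simp add: invertible_det_nz det_mul)

text \<open>Since \<open>y - x = - ((A - mat 1) *v y)\<close> and
  \<open>norm y \<le> norm x + norm (y - x)\<close>, at most half of the error reappears on the
  right and is absorbed; hence the factor \<open>2\<close>.\<close>

lemma perturbed_identity_solution:
  fixes A :: "real^'n^'n"
  assumes small: "op_norm (A - mat 1) \<le> 1/2" and eq: "A *v y = x"
  shows "norm (y - x) \<le> 2 * op_norm (A - mat 1) * norm x"
proof -
  define D where "D = op_norm (A - mat 1)"
  have D: "0 \<le> D" "D \<le> 1/2" using small by (simp_all add: D_def op_norm_nonneg)
  have "y - x = - ((A - mat 1) *v y)"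
    by (simp add: eq matrix_vector_mult_diff_rdistrib)
  then have 1: "norm (y - x) \<le> D * norm y"
    unfolding D_def using norm_matrix_vector_le[of "A - mat 1" y] by (metis norm_minus_cancel)
  also have "\<dots> \<le> D * (norm x + norm (y - x))"
    using D norm_triangle_ineq[of x "y - x"] by (intro mult_left_mono) simp_all
  also have "\<dots> \<le> D * norm x + 1/2 * norm (y - x)"
    using D mult_right_mono[of D "1/2" "norm (y - x)"] by (simp add: distrib_left)
  finally show ?thesis by (simp add: D_def)
qed

text \<open>The conjugated matrix has trivial kernel, by the previous bound with right-hand side
  zero; its determinant is a product, so no factor is singular.\<close>

lemma invertible_of_perturbed_identity:
  fixes R :: "real^'n^'n"
  assumes R: "invertible R" and small: "op_norm (R ** A ** R - mat 1) \<le> 1/2"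
  shows "invertible A"
proof -
  have "x = 0" if "(R ** A ** R) *v x = 0" for x
    using perturbed_identity_solution[OF small that] by simp
  then have "invertible (R ** A ** R)"
    by (simp add: invertible_left_inverse matrix_left_invertible_ker)
  then show ?thesis
    by (simp add: invertible_det_nz det_mul)
qed

text \<open>In coordinates \<open>R\<^sup>-\<^sup>1 p\<close> and \<open>R\<^sup>-\<^sup>1 z\<close>
  the equation is a perturbed identity. With \<open>K = R ** mat_sqrt V\<close>, passing from
  \<open>R *v e\<close> to \<open>sqrt \<Omega>\<^sub>j\<^sub>j\<close> costs the norm of the
  inverse of \<open>K\<close>, and passing to the weighted norm of \<open>z\<close> costs the norm
  of \<open>K\<close>; together they form the condition number.\<close>

lemma component_error_le:
  fixes S A V :: "real^'d^'d"
  defines "R \<equiv> mat_sqrt (matrix_inv S)"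
  assumes S: "mat_psd S" "invertible S" and V: "mat_psd V" "invertible V"
    and small: "op_norm (R ** A ** R - mat 1) \<le> 1/2"
    and eq: "A *v p = S *v z"
  shows "\<bar>p $ j - z $ j\<bar> \<le> 2 * cond_num (R ** mat_sqrt V)
      * (op_norm (R ** A ** R - mat 1) * wnorm (S ** matrix_inv V ** S) z)
      * sqrt ((matrix_inv S ** V ** matrix_inv S) $ j $ j)"
proof -
  define W where "W = mat_sqrt V"
  define K where "K = R ** W"
  define D where "D = op_norm (R ** A ** R - mat 1)"
  have Si: "mat_psd (matrix_inv S)" using S by (rule mat_psd_matrix_inv)
  have RR: "R ** R = matrix_inv S" unfolding R_def using Si by (rule mat_sqrt_square)
  have WW: "W ** W = V" unfolding W_def using V(1) by (rule mat_sqrt_square)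
  have symR: "transpose R = R"
    using mat_psd_mat_sqrt[OF Si] by (simp add: R_def mat_psd_def mat_symmetric_def)
  have symW: "transpose W = W"
    using mat_psd_mat_sqrt[OF V(1)] by (simp add: W_def mat_psd_def mat_symmetric_def)
  have "invertible (R ** R)"
    unfolding RR invertible_def using matrix_inv_mult[OF S(2)] by blast
  then have iR: "invertible R" by (rule invertible_of_square)
  have iW: "invertible W" using V(2) unfolding WW[symmetric] by (rule invertible_of_square)
  have iK: "invertible K" unfolding K_def using iR iW by (simp add: invertible_mult)
  note inv = matrix_inv_mult_vector
  define x where "x = matrix_inv R *v z"
  define y where "y = matrix_inv R *v p"
  have RRS: "R *v (R *v (S *v v)) = v" for v
    using inv(2)[OF S(2), of v] matrix_vector_mul_assoc[of R R "S *v v"] by (simp add: RR)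
  have xS: "x = R *v (S *v z)"
    unfolding x_def using inv(2)[OF iR, of "R *v (S *v z)"] RRS[of z] by simp
  have "(R ** A ** R) *v y = x"
    unfolding y_def xS by (simp add: inv[OF iR] eq flip: matrix_vector_mul_assoc)
  then have yx: "norm (y - x) \<le> 2 * D * norm x"
    unfolding D_def by (rule perturbed_identity_solution[OF small])

  define e :: "real^'d" where "e = axis j 1"
  have comp: "v $ j = e \<bullet> v" for v
    by (simp add: e_def inner_axis' )
  have "p - z = R *v (y - x)"
    by (simp add: x_def y_def matrix_vector_mult_diff_distrib inv[OF iR])
  then have "p $ j - z $ j = (R *v e) \<bullet> (y - x)"
    by (metis comp inner_matrix_symmetric[OF symR] vector_minus_component)
  then have c1: "\<bar>p $ j - z $ j\<bar> \<le> norm (R *v e) * norm (y - x)"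
    by (simp add: Cauchy_Schwarz_ineq2)

  \<comment> \<open>\<open>u\<close> is chosen so that \<open>u \<bullet> u\<close> is the
    \<open>j\<close>-th diagonal entry of the sandwich matrix; as
    \<open>u = transpose K *v (R *v e)\<close>, it also controls \<open>R *v e\<close>.\<close>
  define u where "u = W *v (R *v (R *v e))"
  have "(matrix_inv S ** V ** matrix_inv S) $ j $ j = e \<bullet> ((R ** R ** (W ** W) ** (R ** R)) *v e)"
    unfolding RR WW by (simp add: e_def inner_axis' matrix_vector_mult_basis column_def)
  also have "\<dots> = u \<bullet> u"
    unfolding u_def by (simp add: inner_matrix_symmetric[OF symR] inner_matrix_symmetric[OF symW]
        flip: matrix_vector_mul_assoc)
  finally have Omjj: "sqrt ((matrix_inv S ** V ** matrix_inv S) $ j $ j) = norm u"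
    by (simp add: norm_eq_sqrt_inner)
  have "u = transpose K *v (R *v e)"
    by (simp add: u_def K_def matrix_transpose_mul symR symW matrix_vector_mul_assoc matrix_mul_assoc
        del: transpose_matrix_vector)
  then have "transpose (matrix_inv K) *v u = transpose (K ** matrix_inv K) *v (R *v e)"
    by (simp add: matrix_vector_mul_assoc matrix_mul_assoc matrix_transpose_mul del: transpose_matrix_vector)
  also have "\<dots> = R *v e" by (simp add: matrix_inv_mult[OF iK] transpose_mat del: transpose_matrix_vector)
  finally have c2: "norm (R *v e) \<le> op_norm (matrix_inv K) * norm u"
    by (metis op_norm_transpose_le)

  \<comment> \<open>\<open>q\<close> satisfies \<open>x = K *v q\<close>, and its Euclidean norm is
    exactly the weighted norm of \<open>z\<close>.\<close>
  define q where "q = matrix_inv W *v (S *v z)"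
  have "x = K *v q"
    by (simp add: xS K_def q_def inv[OF iW] flip: matrix_vector_mul_assoc)
  then have c3: "norm x \<le> op_norm K * norm q" by (simp add: norm_matrix_vector_le)
  have symS: "transpose S = S" using S by (simp add: mat_psd_def mat_symmetric_def)
  have Vq: "V *v (matrix_inv W *v q) = S *v z"
    by (simp add: q_def inv[OF iW] flip: WW matrix_vector_mul_assoc)
  have Viq: "matrix_inv V *v (S *v z) = matrix_inv W *v q"
    unfolding Vq[symmetric] by (simp add: inv[OF V(2)])
  have "z \<bullet> ((S ** matrix_inv V ** S) *v z) = (S *v z) \<bullet> (matrix_inv W *v q)"
    by (simp add: inner_matrix_symmetric[OF symS] Viq flip: matrix_vector_mul_assoc)
  also have "S *v z = W *v q" by (simp add: q_def inv[OF iW])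
  also have "(W *v q) \<bullet> (matrix_inv W *v q) = q \<bullet> q"
    by (simp add: inner_matrix_symmetric[OF symW] inv[OF iW])
  finally have wn: "wnorm (S ** matrix_inv V ** S) z = norm q"
    by (simp add: wnorm_def norm_eq_sqrt_inner)

  have D0: "0 \<le> D" by (simp add: D_def op_norm_nonneg)
  have "\<bar>p $ j - z $ j\<bar> \<le> (op_norm (matrix_inv K) * norm u) * (2 * D * (op_norm K * norm q))"
  proof (rule order_trans[OF c1 mult_mono[OF c2]])
    show "norm (y - x) \<le> 2 * D * (op_norm K * norm q)"
      using D0 by (intro order_trans[OF yx] mult_left_mono[OF c3]) simp
  qed (simp_all add: op_norm_nonneg)
  then show ?thesis
    by (simp add: Omjj wn cond_num_def mult_ac D_def[symmetric] flip: K_def W_def)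
qed

section \<open>Gaussian tails, second moments and semidefiniteness\<close>

lemma nn_integral_normal_density:
  assumes "0 < \<sigma>"
  shows "(\<integral>\<^sup>+x. ennreal (normal_density \<mu> \<sigma> x) \<partial>lborel) = 1"
proof -
  interpret prob_space "density lborel (normal_density \<mu> \<sigma>)"
    using assms by (rule prob_space_normal_density)
  show ?thesis using emeasure_space_1 by (simp add: emeasure_density)
qed

text \<open>On each tail the density is at most \<open>exp (- s\<^sup>2 / 2)\<close> times a
  unit-variance normal density centred at \<open>s\<close> or \<open>- s\<close>; the two have total
  mass \<open>2\<close>.\<close>

lemma std_normal_tail:
  assumes s: "0 \<le> s"
  shows "measure (density lborel std_normal_density) {x. s < \<bar>x\<bar>} \<le> 2 * exp (- s\<^sup>2 / 2)"
proof -
  interpret prob_space "density lborel std_normal_density"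
    by (rule prob_space_normal_density) simp
  \<comment> \<open>\<open>x\<^sup>2 \<ge> s\<^sup>2 + (\<bar>x\<bar> - s)\<^sup>2\<close> on the tail\<close>
  have shift: "std_normal_density x * indicator {x. s < \<bar>x\<bar>} x
      \<le> exp (- s\<^sup>2 / 2) * (normal_density s 1 x + normal_density (- s) 1 x)" for x
  proof (cases "s < \<bar>x\<bar>")
    case True
    define c where "c = (if x > 0 then s else - s)"
    have "c\<^sup>2 = s\<^sup>2" "c * x \<ge> s\<^sup>2"
      using True s mult_left_mono[of s x s] mult_left_mono[of s "- x" s]
      by (auto simp: c_def power2_eq_square)
    then have "c\<^sup>2 \<le> c * x" by simp
    then have "- x\<^sup>2 / 2 \<le> - s\<^sup>2 / 2 + - (x - c)\<^sup>2 / 2"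
      using \<open>c\<^sup>2 = s\<^sup>2\<close> by (simp add: power2_diff field_simps)
    then have "exp (- x\<^sup>2 / 2) \<le> exp (- s\<^sup>2 / 2) * exp (- (x - c)\<^sup>2 / 2)"
      by (simp flip: exp_add)
    then have "std_normal_density x \<le> exp (- s\<^sup>2 / 2) * normal_density c 1 x"
      by (simp add: normal_density_def divide_right_mono)
    also have "\<dots> \<le> exp (- s\<^sup>2 / 2) * (normal_density s 1 x + normal_density (- s) 1 x)"
      by (intro mult_left_mono) (auto simp: c_def)
    finally show ?thesis using True by simp
  qed (auto intro!: mult_nonneg_nonneg add_nonneg_nonneg)
  have "ennreal (measure (density lborel std_normal_density) {x. s < \<bar>x\<bar>})
      = (\<integral>\<^sup>+x. ennreal (std_normal_density x) * indicator {x. s < \<bar>x\<bar>} x \<partial>lborel)"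
    by (simp add: emeasure_density flip: emeasure_eq_measure)
  also have "\<dots> \<le> (\<integral>\<^sup>+x. ennreal (exp (- s\<^sup>2 / 2)) * (ennreal (normal_density s 1 x) + ennreal (normal_density (- s) 1 x)) \<partial>lborel)"
  proof (rule nn_integral_mono)
    fix x
    show "ennreal (std_normal_density x) * indicator {x. s < \<bar>x\<bar>} x
        \<le> ennreal (exp (- s\<^sup>2 / 2)) * (ennreal (normal_density s 1 x) + ennreal (normal_density (- s) 1 x))"
      using ennreal_leI[OF shift[of x]]
      by (cases "s < \<bar>x\<bar>") (simp_all add: ennreal_mult[symmetric] ennreal_plus[symmetric] del: ennreal_plus)
  qed
  also have "\<dots> = ennreal (exp (- s\<^sup>2 / 2)) * 2"
    by (simp add: nn_integral_cmult nn_integral_add nn_integral_normal_density)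
  also have "\<dots> = ennreal (2 * exp (- s\<^sup>2 / 2))"
    by (simp add: ennreal_mult' mult.commute)
  finally show ?thesis by simp
qed

text \<open>A normal density depends on its deviation only through the square, and
  \<open>sqrt q\<close> squares to \<open>\<bar>q\<bar>\<close> for either sign of
  \<open>q\<close>.\<close>

lemma centered_gaussian_distr_inner:
  assumes G: "centered_gaussian N G C"
  shows "distr N borel (\<lambda>\<omega>. a \<bullet> G \<omega>) = (if a \<bullet> (C *v a) = 0 then return borel 0
      else density lborel (normal_density 0 (sqrt \<bar>a \<bullet> (C *v a)\<bar>)))"
proof -
  have "(sqrt q)\<^sup>2 = \<bar>q\<bar>" for q
    by (metis power2_eq_square real_sqrt_abs2 real_sqrt_mult)
  then have "normal_density 0 (sqrt q) = normal_density 0 (sqrt \<bar>q\<bar>)" for q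
    by (intro ext) (simp add: normal_density_def)
  then show ?thesis
    using G by (simp add: centered_gaussian_def)
qed

text \<open>Second moments turn the family of one-dimensional laws into an identity of forms, from
  which the sign of \<open>C\<close> is later recovered.\<close>

lemma centered_gaussian_second_moment:
  assumes G: "centered_gaussian N G C"
  shows "integrable N (\<lambda>\<omega>. (a \<bullet> G \<omega>)\<^sup>2)" "(\<integral>\<omega>. (a \<bullet> G \<omega>)\<^sup>2 \<partial>N) = \<bar>a \<bullet> (C *v a)\<bar>"
proof -
  define q where "q = a \<bullet> (C *v a)"
  define \<sigma> where "\<sigma> = sqrt \<bar>q\<bar>"
  have [measurable]: "G \<in> borel_measurable N" using G by (simp add: centered_gaussian_def)
  have d: "distr N borel (\<lambda>\<omega>. a \<bullet> G \<omega>) = (if q = 0 then return borel 0 else density lborel (normal_density 0 \<sigma>))"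
    unfolding q_def \<sigma>_def by (rule centered_gaussian_distr_inner[OF G])
  have "integrable (distr N borel (\<lambda>\<omega>. a \<bullet> G \<omega>)) (\<lambda>x. x\<^sup>2) \<and> (\<integral>x. x\<^sup>2 \<partial>distr N borel (\<lambda>\<omega>. a \<bullet> G \<omega>)) = \<bar>q\<bar>"
  proof (cases "q = 0")
    case True
    have "integrable (return borel (0::real)) (\<lambda>x. x\<^sup>2)"
      by (rule integrableI_bounded) (simp_all add: nn_integral_return)
    then show ?thesis using True by (simp add: d integral_return)
  next
    case False
    then have \<sigma>: "0 < \<sigma>" by (simp add: \<sigma>_def)
    have "integrable lborel (\<lambda>x. normal_density 0 \<sigma> x * x\<^sup>2)"
      using integrable_normal_moment[OF \<sigma>, of 0 2] by simp
    moreover have "(\<integral>x. normal_density 0 \<sigma> x * x\<^sup>2 \<partial>lborel) = \<sigma>\<^sup>2"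
      using integral_normal_moment_even[OF \<sigma>, of 0 1] \<sigma> by (simp add: fact_numeral)
    ultimately show ?thesis
      using False by (simp add: d integrable_density integral_density \<sigma>_def)
  qed
  then show "integrable N (\<lambda>\<omega>. (a \<bullet> G \<omega>)\<^sup>2)" "(\<integral>\<omega>. (a \<bullet> G \<omega>)\<^sup>2 \<partial>N) = \<bar>a \<bullet> (C *v a)\<bar>"
    by (simp_all add: integrable_distr_eq integral_distr q_def)
qed

text \<open>The value \<open>0\<close> is the degenerate case, a point mass at zero; the value
  \<open>1\<close> is the standard normal law whatever the sign of the form.\<close>

lemma centered_gaussian_tail:
  assumes G: "centered_gaussian N G C" and q: "\<bar>a \<bullet> (C *v a)\<bar> \<in> {0, 1}" and s: "0 \<le> s"
  shows "measure N {x \<in> space N. s < \<bar>a \<bullet> G x\<bar>} \<le> 2 * exp (- s\<^sup>2 / 2)"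
proof -
  have [measurable]: "G \<in> borel_measurable N" using G by (simp add: centered_gaussian_def)
  have "measure N {x \<in> space N. s < \<bar>a \<bullet> G x\<bar>} = measure (distr N borel (\<lambda>x. a \<bullet> G x)) {x. s < \<bar>x\<bar>}"
    by (subst measure_distr) (auto intro!: arg_cong[where f = "measure N"])
  also have "\<dots> \<le> 2 * exp (- s\<^sup>2 / 2)"
  proof (cases "a \<bullet> (C *v a) = 0")
    case True
    then show ?thesis
      using s by (simp add: centered_gaussian_distr_inner[OF G] measure_return)
  next
    case False
    then show ?thesis
      using q std_normal_tail[OF s] by (simp add: centered_gaussian_distr_inner[OF G])
  qed
  finally show ?thesis .
qed

text \<open>
  For an indefinite \<open>C\<close>, the square root of a negative number is negative and a density with negative
  deviation is that of its absolute value, so \<open>centered_gaussian\<close> only says that the variance of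
  \<open>a \<bullet> G\<close> is \<open>\<bar>a \<bullet> C a\<bar>\<close>. Both forms satisfy the parallelogram law, which near a point where
  \<open>C\<close> is positive forces them to agree.
\<close>

lemma centered_gaussian_quadratic_form_nonneg:
  fixes C :: "real^'n^'n"
  assumes G: "centered_gaussian N G C" and e: "0 < e \<bullet> (C *v e)"
  shows "0 \<le> a \<bullet> (C *v a)"
proof -
  define q where "q x = x \<bullet> (C *v x)" for x
  note i = centered_gaussian_second_moment(1)[OF G] and p = centered_gaussian_second_moment(2)[OF G, folded q_def]
  have par: "\<bar>q (x + y)\<bar> + \<bar>q (x - y)\<bar> = 2 * \<bar>q x\<bar> + 2 * \<bar>q y\<bar>" for x y
  proof -
    have "\<bar>q (x + y)\<bar> + \<bar>q (x - y)\<bar> = (\<integral>\<omega>. ((x + y) \<bullet> G \<omega>)\<^sup>2 + ((x - y) \<bullet> G \<omega>)\<^sup>2 \<partial>N)"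
      by (simp add: Bochner_Integration.integral_add[OF i i] flip: p)
    also have "\<dots> = (\<integral>\<omega>. 2 * (x \<bullet> G \<omega>)\<^sup>2 + 2 * (y \<bullet> G \<omega>)\<^sup>2 \<partial>N)"
      by (rule Bochner_Integration.integral_cong) (simp_all add: inner_add_left inner_diff_left power2_sum power2_diff)
    also have "\<dots> = 2 * \<bar>q x\<bar> + 2 * \<bar>q y\<bar>"
      by (simp add: i flip: p)
    finally show ?thesis .
  qed
  have qpar: "q (x + y) + q (x - y) = 2 * q x + 2 * q y" for x y
    by (simp add: q_def inner_add_left inner_add_right inner_diff_left inner_diff_right algebra_simps)
  have "((\<lambda>s. q (e + s *\<^sub>R a)) \<longlongrightarrow> q (e + 0 *\<^sub>R a)) (at 0)" "((\<lambda>s. q (e - s *\<^sub>R a)) \<longlongrightarrow> q (e - 0 *\<^sub>R a)) (at 0)"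
    unfolding q_def by (intro tendsto_intros bounded_linear.tendsto[OF matrix_vector_mul_bounded_linear])+
  then have "\<forall>\<^sub>F s in at 0. 0 < q (e + s *\<^sub>R a)" "\<forall>\<^sub>F s in at 0. 0 < q (e - s *\<^sub>R a)"
    using e by (auto intro!: order_tendstoD simp: q_def)
  then have "\<forall>\<^sub>F s in at (0::real). s \<noteq> 0 \<and> 0 < q (e + s *\<^sub>R a) \<and> 0 < q (e - s *\<^sub>R a)"
    by (auto simp: eventually_conj_iff eventually_at_filter)
  then obtain s :: real where s: "s \<noteq> 0" "0 < q (e + s *\<^sub>R a)" "0 < q (e - s *\<^sub>R a)"
    by (auto dest!: eventually_happens'[OF at_neq_bot])
  \<comment> \<open>At \<open>e\<close> and \<open>e \<plusminus> s *\<^sub>R a\<close> the form is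
    positive, so subtracting the two parallelogram laws cancels everything except the terms at
    \<open>s *\<^sub>R a\<close>.\<close>
  then have "q (s *\<^sub>R a) = \<bar>q (s *\<^sub>R a)\<bar>"
    using par[of e "s *\<^sub>R a"] qpar[of e "s *\<^sub>R a"] e by (simp add: q_def)
  then have "0 \<le> s\<^sup>2 * q a"
    by (simp add: q_def matrix_vector_mult_scaleR power2_eq_square)
  then show ?thesis using s(1) by (simp add: q_def zero_le_mult_iff)
qed

section \<open>Measurability of matrix operations\<close>

lemma borel_measurable_vecI:
  fixes f :: "'a \<Rightarrow> 'b::euclidean_space^'n"
  assumes "\<And>i. (\<lambda>x. f x $ i) \<in> borel_measurable M"
  shows "f \<in> borel_measurable M"
  using assms by (subst borel_measurable_euclidean_space) (auto simp: Basis_vec_def inner_axis)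

lemma borel_measurable_vec_nth [measurable (raw)]:
  fixes f :: "'a \<Rightarrow> 'b::euclidean_space^'n"
  assumes "f \<in> borel_measurable M"
  shows "(\<lambda>x. f x $ i) \<in> borel_measurable M"
  by (rule measurable_compose[OF assms])
     (auto intro!: borel_measurable_continuous_onI continuous_intros)

lemma borel_measurable_matrix_mult [measurable (raw)]:
  fixes A B :: "'a \<Rightarrow> real^'n^'n"
  assumes [measurable]: "A \<in> borel_measurable M" "B \<in> borel_measurable M"
  shows "(\<lambda>x. A x ** B x) \<in> borel_measurable M"
  by (intro borel_measurable_vecI) (simp add: matrix_matrix_mult_def)

lemma borel_measurable_matrix_vector_mult [measurable (raw)]:
  fixes A :: "'a \<Rightarrow> real^'n^'n" and b :: "'a \<Rightarrow> real^'n"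
  assumes [measurable]: "A \<in> borel_measurable M" "b \<in> borel_measurable M"
  shows "(\<lambda>x. A x *v b x) \<in> borel_measurable M"
  by (intro borel_measurable_vecI) (simp add: matrix_vector_mult_def)

lemma borel_measurable_det [measurable (raw)]:
  fixes A :: "'a \<Rightarrow> real^'n^'n"
  assumes [measurable]: "A \<in> borel_measurable M"
  shows "(\<lambda>x. det (A x)) \<in> borel_measurable M"
  unfolding det_def by measurable

text \<open>Cramer's rule gives a quotient of determinants where \<open>A x\<close> is regular.
  Where it is singular, \<open>matrix_inv\<close> chooses from the empty predicate, which yields one
  fixed matrix independent of \<open>x\<close>.\<close>

lemma borel_measurable_matrix_inv_mult_vector:
  fixes A :: "'a \<Rightarrow> real^'n^'n" and b :: "'a \<Rightarrow> real^'n"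
  assumes [measurable]: "A \<in> borel_measurable M" "b \<in> borel_measurable M"
  shows "(\<lambda>x. matrix_inv (A x) *v b x) \<in> borel_measurable M"
proof -
  have eq: "matrix_inv (A x) *v b x =
      (if det (A x) = 0 then (SOME B. False) *v b x
       else (\<chi> k. det (\<chi> i j. if j = k then b x $ i else A x $ i $ j) / det (A x)))" for x
  proof (cases "det (A x) = 0")
    case True
    then have "(\<lambda>B. A x ** B = mat 1 \<and> B ** A x = mat 1) = (\<lambda>B. False)"
      using invertible_det_nz[of "A x"] by (auto simp: invertible_def)
    then show ?thesis using True unfolding matrix_inv_def by simp
  next
    case False
    then have "invertible (A x)" by (simp add: invertible_det_nz)
    then have "A x *v (matrix_inv (A x) *v b x) = b x"
      by (rule matrix_inv_mult_vector)
    then show ?thesis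
      using cramer[OF False] False by auto
  qed
  have [measurable]: "(\<lambda>x. (\<chi> i j. if j = k then b x $ i else A x $ i $ j) :: real^'n^'n) \<in> borel_measurable M" for k
    by (intro borel_measurable_vecI) simp
  have "(\<lambda>x. (\<chi> k. det (\<chi> i j. if j = k then b x $ i else A x $ i $ j) / det (A x)) :: real^'n) \<in> borel_measurable M"
    by (intro borel_measurable_vecI) simp
  then show ?thesis unfolding eq by measurable
qed

text \<open>By the reverse triangle inequality, \<open>op_norm\<close> changes by at most the sum of
  the absolute entries of the difference.\<close>

lemma continuous_on_op_norm: "continuous_on S (op_norm :: real^'n^'n \<Rightarrow> real)"
proof (rule continuous_at_imp_continuous_on, rule ballI)
  fix A :: "real^'n^'n"
  have le: "op_norm P \<le> op_norm (P - Q) + op_norm Q" for P Q :: "real^'n^'n"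
    using onorm_triangle[of "(*v) (P - Q)" "(*v) Q"]
    by (simp add: op_norm_def flip: matrix_vector_mult_add_rdistrib)
  have bound: "norm (op_norm B - op_norm A) \<le> (\<Sum>i\<in>UNIV. \<Sum>j\<in>UNIV. \<bar>B $ i $ j - A $ i $ j\<bar>)" for B
  proof -
    have "op_norm (A - B) = op_norm (B - A)"
      using onorm_neg[of "\<lambda>x. (B - A) *v x"]
      by (simp add: op_norm_def matrix_vector_mult_diff_rdistrib fun_Compl_def)
    then have "norm (op_norm B - op_norm A) \<le> op_norm (B - A)"
      using le[of B A] le[of A B] by (simp add: abs_le_iff)
    also have "\<dots> \<le> (\<Sum>i\<in>UNIV. \<Sum>j\<in>UNIV. \<bar>(B - A) $ i $ j\<bar>)"
      unfolding op_norm_def by (rule onorm_le_matrix_component_sum)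
    finally show ?thesis by simp
  qed
  have "((\<lambda>B. op_norm B - op_norm A) \<longlongrightarrow> 0) (at A)"
  proof (rule Lim_null_comparison)
    show "\<forall>\<^sub>F B in at A. norm (op_norm B - op_norm A) \<le> (\<Sum>i\<in>UNIV. \<Sum>j\<in>UNIV. \<bar>B $ i $ j - A $ i $ j\<bar>)"
      by (intro always_eventually allI bound)
    have "((\<lambda>B. \<Sum>i\<in>UNIV. \<Sum>j\<in>UNIV. \<bar>B $ i $ j - A $ i $ j\<bar>)
        \<longlongrightarrow> (\<Sum>i\<in>UNIV. \<Sum>j\<in>UNIV. \<bar>A $ i $ j - A $ i $ j\<bar>)) (at A)"
      by (intro tendsto_intros)
    then show "((\<lambda>B. \<Sum>i\<in>UNIV. \<Sum>j\<in>UNIV. \<bar>B $ i $ j - A $ i $ j\<bar>) \<longlongrightarrow> 0) (at A)"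
      by simp
  qed
  then show "isCont op_norm A"
    by (simp add: isCont_def LIM_zero_iff)
qed

lemma borel_measurable_op_norm [measurable (raw)]:
  assumes "A \<in> borel_measurable M"
  shows "(\<lambda>x. op_norm (A x)) \<in> borel_measurable M"
  by (rule measurable_compose[OF assms borel_measurable_continuous_onI[OF continuous_on_op_norm]])

section \<open>Comparison of distribution functions under a small shift\<close>

text \<open>Outside \<open>B\<close>, where \<open>E\<close> fails or \<open>h\<close> exceeds
  \<open>s\<close>, the functions \<open>f\<close> and \<open>h\<close> differ by at most
  \<open>\<delta>\<close>. One \<open>\<Delta>\<close> pays for the tail of \<open>h\<close> in
  \<open>B\<close>, the other for replacing \<open>h\<close> by \<open>g\<close> at the shifted
  level, and \<open>K\<close> pays for undoing the shift.\<close>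

lemma kolmogorov_distance_perturbation:
  fixes f h :: "'a \<Rightarrow> real" and g :: "'b \<Rightarrow> real"
  assumes M: "prob_space M" and N: "prob_space N"
    and [measurable]: "f \<in> borel_measurable M" "h \<in> borel_measurable M" "g \<in> borel_measurable N" "E \<in> sets M"
    and close: "\<And>\<omega>. \<omega> \<in> E \<Longrightarrow> h \<omega> \<le> s \<Longrightarrow> \<bar>f \<omega> - h \<omega>\<bar> \<le> \<delta>"
    and g0: "\<And>x. x \<in> space N \<Longrightarrow> 0 \<le> g x" and s: "0 \<le> s" and \<delta>: "0 \<le> \<delta>"
    and tail: "measure N {x \<in> space N. s < g x} \<le> \<tau>"
    and \<Delta>: "\<And>u. 0 \<le> u \<Longrightarrow> \<bar>measure M {\<omega> \<in> space M. h \<omega> \<le> u} - measure N {x \<in> space N. g x \<le> u}\<bar> \<le> \<Delta>"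
    and K: "\<And>u. 0 \<le> u \<Longrightarrow> measure N {x \<in> space N. u \<le> g x \<and> g x \<le> u + \<delta>} \<le> K"
    and t: "0 \<le> t"
  shows "\<bar>measure M {\<omega> \<in> space M. f \<omega> \<le> t} - measure N {x \<in> space N. g x \<le> t}\<bar>
      \<le> 2 * \<Delta> + measure M (space M - E) + \<tau> + K"
proof -
  interpret M: prob_space M by (rule M)
  interpret N: prob_space N by (rule N)
  define F where "F u = measure M {\<omega> \<in> space M. f \<omega> \<le> u}" for u
  define H where "H u = measure M {\<omega> \<in> space M. h \<omega> \<le> u}" for u
  define L where "L u = measure N {x \<in> space N. g x \<le> u}" for u
  define B where "B = (space M - E) \<union> {\<omega> \<in> space M. s < h \<omega>}"
  have [measurable]: "B \<in> sets M" by (simp add: B_def)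
  have L_step: "L (u + \<delta>) \<le> L u + K" if "0 \<le> u" for u
  proof -
    have "L (u + \<delta>) \<le> measure N ({x \<in> space N. g x \<le> u} \<union> {x \<in> space N. u \<le> g x \<and> g x \<le> u + \<delta>})"
      unfolding L_def by (rule N.finite_measure_mono) auto
    also have "\<dots> \<le> L u + measure N {x \<in> space N. u \<le> g x \<and> g x \<le> u + \<delta>}"
      unfolding L_def by (rule measure_Un_le) auto
    finally show ?thesis using K[OF that] by simp
  qed
  have "measure N {x \<in> space N. s < g x} = 1 - L s"
    unfolding L_def using N.prob_neg[of "\<lambda>x. g x \<le> s"] by (simp add: not_le)
  moreover have "measure M {\<omega> \<in> space M. s < h \<omega>} = 1 - H s"
    unfolding H_def using M.prob_neg[of "\<lambda>x. h x \<le> s"] by (simp add: not_le)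
  ultimately have "measure M {\<omega> \<in> space M. s < h \<omega>} \<le> \<Delta> + \<tau>"
    using tail \<Delta>[OF s] by (simp add: H_def L_def)
  moreover have "measure M B \<le> measure M (space M - E) + measure M {\<omega> \<in> space M. s < h \<omega>}"
    unfolding B_def by (rule measure_Un_le) auto
  ultimately have PB: "measure M B \<le> measure M (space M - E) + \<Delta> + \<tau>" by simp
  have HL: "\<bar>H u - L u\<bar> \<le> \<Delta>" if "0 \<le> u" for u
    using \<Delta>[OF that] by (simp add: H_def L_def)
  have cl: "\<bar>f \<omega> - h \<omega>\<bar> \<le> \<delta>" if "\<omega> \<in> space M" "\<omega> \<notin> B" for \<omega>
    using that close by (auto simp: B_def not_less)
  have "F t \<le> measure M ({\<omega> \<in> space M. h \<omega> \<le> t + \<delta>} \<union> B)"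
    unfolding F_def by (rule M.finite_measure_mono) (use cl in \<open>force\<close>, measurable)
  also have "\<dots> \<le> H (t + \<delta>) + measure M B"
    unfolding H_def by (rule measure_Un_le) auto
  also have "H (t + \<delta>) \<le> L (t + \<delta>) + \<Delta>"
    using HL[of "t + \<delta>"] t \<delta> by simp
  finally have up: "F t - L t \<le> 2 * \<Delta> + measure M (space M - E) + \<tau> + K"
    using L_step[OF t] PB by simp
  have "L t - F t \<le> 2 * \<Delta> + measure M (space M - E) + \<tau> + K"
  proof (cases "\<delta> \<le> t")
    case True
    have "H (t - \<delta>) \<le> measure M ({\<omega> \<in> space M. f \<omega> \<le> t} \<union> B)"
      unfolding H_def by (rule M.finite_measure_mono) (use cl in \<open>force\<close>, measurable)
    also have "\<dots> \<le> F t + measure M B"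
      unfolding F_def by (rule measure_Un_le) auto
    finally show ?thesis
      using L_step[of "t - \<delta>"] HL[of "t - \<delta>"] PB True by simp
  next
    \<comment> \<open>For \<open>t < \<delta>\<close> the level \<open>t - \<delta>\<close> is
      negative, where \<open>\<Delta>\<close> and \<open>K\<close> give no bound. Instead
      \<open>L t\<close> is at most the mass of \<open>[0, \<delta>]\<close>, hence at most
      \<open>K\<close>.\<close>
    case False
    have "L t \<le> measure N {x \<in> space N. 0 \<le> g x \<and> g x \<le> 0 + \<delta>}"
      unfolding L_def by (rule N.finite_measure_mono) (use g0 False in auto)
    moreover have "0 \<le> F t" by (simp add: F_def)
    moreover have "0 \<le> \<Delta>" using HL[OF t] by simp
    moreover have "0 \<le> \<tau>" using tail measure_nonneg order_trans by blast
    moreover have "0 \<le> measure M (space M - E)" by simp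
    ultimately show ?thesis using K[of 0] by linarith
  qed
  with up show ?thesis by (simp add: F_def L_def abs_le_iff)
qed

section \<open>Second-moment, covariance and correlation matrices\<close>

lemma mat_psd_scaleR:
  assumes "mat_psd A" "0 \<le> c"
  shows "mat_psd (c *\<^sub>R A)"
  using assms by (simp add: mat_psd_def mat_symmetric_def transpose_scalar flip: scaleR_matrix_vector_assoc)

lemma sum_matrix_vector_mult:
  fixes A :: "'i \<Rightarrow> real^'n^'m"
  shows "(\<Sum>i\<in>I. A i) *v x = (\<Sum>i\<in>I. A i *v x)"
  by (induction I rule: infinite_finite_induct) (simp_all add: matrix_vector_mult_add_rdistrib)

lemma mat_psd_sum:
  assumes "\<And>i. i \<in> I \<Longrightarrow> mat_psd (A i)"
  shows "mat_psd (\<Sum>i\<in>I. A i)"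
proof -
  have "transpose (\<Sum>i\<in>I. A i) = (\<Sum>i\<in>I. A i)"
    using assms by (simp add: mat_psd_def mat_symmetric_def transpose_def vec_eq_iff)
  moreover have "0 \<le> x \<bullet> ((\<Sum>i\<in>I. A i) *v x)" for x
    using assms by (auto simp: mat_psd_def sum_matrix_vector_mult inner_sum_right intro!: sum_nonneg)
  ultimately show ?thesis by (simp add: mat_psd_def mat_symmetric_def)
qed

text \<open>The quadratic form at \<open>x\<close> is the mean of
  \<open>(x \<bullet> Z \<omega>)\<^sup>2\<close>; square integrability makes the products
  integrable, so sum and integral can be exchanged.\<close>

lemma mat_psd_mexp_outer:
  fixes Z :: "'a \<Rightarrow> real^'n"
  assumes [measurable]: "Z \<in> borel_measurable M"
    and L2: "\<And>j. integrable M (\<lambda>\<omega>. (Z \<omega> $ j)\<^sup>2)"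
  shows "mat_psd (mexp M (\<lambda>\<omega>. outer (Z \<omega>) (Z \<omega>)))"
proof -
  have i: "integrable M (\<lambda>\<omega>. Z \<omega> $ j * Z \<omega> $ k)" for j k
  proof (rule Bochner_Integration.integrable_bound)
    show "integrable M (\<lambda>\<omega>. (Z \<omega> $ j)\<^sup>2 + (Z \<omega> $ k)\<^sup>2)" by (simp add: L2)
    have "\<bar>a * b\<bar> \<le> a\<^sup>2 + b\<^sup>2" for a b :: real
    proof -
      have "2 * (\<bar>a\<bar> * \<bar>b\<bar>) \<le> a\<^sup>2 + b\<^sup>2"
        using sum_squares_bound[of "\<bar>a\<bar>" "\<bar>b\<bar>"] by (simp add: mult.assoc)
      moreover have "0 \<le> \<bar>a\<bar> * \<bar>b\<bar>" by simp
      ultimately show ?thesis unfolding abs_mult by linarith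
    qed
    then show "AE \<omega> in M. norm (Z \<omega> $ j * Z \<omega> $ k) \<le> norm ((Z \<omega> $ j)\<^sup>2 + (Z \<omega> $ k)\<^sup>2)"
      by simp
  qed measurable
  have "x \<bullet> (mexp M (\<lambda>\<omega>. outer (Z \<omega>) (Z \<omega>)) *v x) = (\<integral>\<omega>. (x \<bullet> Z \<omega>)\<^sup>2 \<partial>M)" for x
  proof -
    have "x \<bullet> (mexp M (\<lambda>\<omega>. outer (Z \<omega>) (Z \<omega>)) *v x)
        = (\<Sum>j\<in>UNIV. \<Sum>k\<in>UNIV. (x $ j * x $ k) * (\<integral>\<omega>. Z \<omega> $ j * Z \<omega> $ k \<partial>M))"
      by (simp add: mexp_def outer_def inner_vec_def matrix_vector_mult_def sum_distrib_left mult_ac)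
    also have "\<dots> = (\<integral>\<omega>. (\<Sum>j\<in>UNIV. \<Sum>k\<in>UNIV. (x $ j * x $ k) * (Z \<omega> $ j * Z \<omega> $ k)) \<partial>M)"
      by (simp add: i)
    also have "\<dots> = (\<integral>\<omega>. (x \<bullet> Z \<omega>)\<^sup>2 \<partial>M)"
      by (simp add: inner_vec_def power2_eq_square sum_product mult_ac)
    finally show ?thesis .
  qed
  moreover have "transpose (mexp M (\<lambda>\<omega>. outer (Z \<omega>) (Z \<omega>))) = mexp M (\<lambda>\<omega>. outer (Z \<omega>) (Z \<omega>))"
    by (simp add: mexp_def outer_def transpose_def vec_eq_iff mult.commute)
  ultimately show ?thesis
    by (simp add: mat_psd_def mat_symmetric_def)
qed

text \<open>Mirrored entries integrate the same function, so symmetry survives the default values of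
  non-integrable entries.\<close>

lemma mat_symmetric_cov_mat: "mat_symmetric (cov_mat M Z)"
  by (simp add: cov_mat_def mexp_def outer_def mat_symmetric_def transpose_def vec_eq_iff mult.commute)

lemma outer_mult_vector: "outer x y *v b = (y \<bullet> b) *\<^sub>R x"
  by (simp add: outer_def matrix_vector_mult_def vec_eq_iff inner_vec_def sum_distrib_left sum_distrib_right mult_ac)

text \<open>Normalising to correlations is a diagonal congruence and \<open>w\<close> undoes it, so
  nonnegativity passes from \<open>corr_mat A\<close> to \<open>A\<close>.\<close>

lemma corr_mat_quadratic_form:
  fixes A :: "real^'n^'n"
  assumes "\<And>i. 0 < A $ i $ i"
  defines "w \<equiv> \<lambda>y. \<chi> i. sqrt (A $ i $ i) * y $ i"
  shows "w y \<bullet> (corr_mat A *v w y) = y \<bullet> (A *v y)"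
proof -
  have s: "sqrt (A $ i $ i) \<noteq> 0" for i using assms(1)[of i] by simp
  show ?thesis
    unfolding inner_vec_def matrix_vector_mult_def w_def corr_mat_def
    using s by (auto intro!: sum.cong simp: sum_distrib_left field_simps)
qed

text \<open>As \<open>sqrt\<close> is odd, a negative diagonal entry normalises to
  \<open>-1\<close>; a zero entry gives \<open>0 / 0 = 0\<close>.\<close>

lemma abs_corr_mat_diag: "\<bar>corr_mat A $ i $ i\<bar> \<in> {0, 1}"
  by (auto simp: corr_mat_def)

lemma Max_abs_diff_le:
  fixes a b :: "'n::finite \<Rightarrow> real"
  assumes "\<And>j. \<bar>a j - b j\<bar> \<le> \<delta>"
  shows "\<bar>(MAX j. \<bar>a j\<bar>) - (MAX j. \<bar>b j\<bar>)\<bar> \<le> \<delta>"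
proof -
  have *: "(MAX j. \<bar>u j\<bar>) \<le> (MAX j. \<bar>v j\<bar>) + \<delta>" if "\<And>j. \<bar>u j - v j\<bar> \<le> \<delta>" for u v :: "'n \<Rightarrow> real"
  proof (rule Max.boundedI)
    fix y assume "y \<in> range (\<lambda>j. \<bar>u j\<bar>)"
    then obtain j where "y = \<bar>u j\<bar>" by blast
    moreover have "\<bar>v j\<bar> \<le> (MAX j. \<bar>v j\<bar>)" by (rule Max_ge) auto
    ultimately show "y \<le> (MAX j. \<bar>v j\<bar>) + \<delta>" using that[of j] by linarith
  qed auto
  show ?thesis
    using *[of a b, OF assms] *[of b a, OF assms[unfolded abs_minus_commute[of "a _"]]] by linarith
qed

section \<open>Application to the least squares estimator\<close>

theorem mainTheorem3:
  fixes M :: "'a measure" and N :: "'b measure"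
    and X :: "nat \<Rightarrow> 'a \<Rightarrow> real^'d" and Y :: "nat \<Rightarrow> 'a \<Rightarrow> real"
    and n :: nat and Omh :: "'a \<Rightarrow> real^'d^'d" and eta :: real
    and G :: "'b \<Rightarrow> real^'d"
  assumes M: "prob_space M"
    and n_pos: "0 < n"
    and X_meas: "\<And>i. i < n \<Longrightarrow> X i \<in> borel_measurable M"
    and Y_meas: "\<And>i. i < n \<Longrightarrow> Y i \<in> borel_measurable M"
    and X_L2: "\<And>i j. i < n \<Longrightarrow> integrable M (\<lambda>\<omega>. (X i \<omega> $ j)\<^sup>2)"
    and Y_L2: "\<And>i. i < n \<Longrightarrow> integrable M (\<lambda>\<omega>. (Y i \<omega>)\<^sup>2)"
    and Omh_meas: "Omh \<in> borel_measurable M"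
    and Omh_sym: "\<And>\<omega>. \<omega> \<in> space M \<Longrightarrow> mat_symmetric (Omh \<omega>)"
    and Omh_diag: "\<And>\<omega> j. \<omega> \<in> space M \<Longrightarrow> 0 < Omh \<omega> $ j $ j"
    and eta_pos: "0 < eta"
  defines "Sig \<equiv> (1 / real n) *\<^sub>R (\<Sum>i<n. mexp M (\<lambda>\<omega>. outer (X i \<omega>) (X i \<omega>)))"
    and "Gam \<equiv> (1 / real n) *\<^sub>R (\<Sum>i<n. vexp M (\<lambda>\<omega>. Y i \<omega> *\<^sub>R X i \<omega>))"
  defines "beta \<equiv> matrix_inv Sig *v Gam"
    and "Sigh \<equiv> (\<lambda>\<omega>. (1 / real n) *\<^sub>R (\<Sum>i<n. outer (X i \<omega>) (X i \<omega>)))"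
    and "Gamh \<equiv> (\<lambda>\<omega>. (1 / real n) *\<^sub>R (\<Sum>i<n. Y i \<omega> *\<^sub>R X i \<omega>))"
  defines "betah \<equiv> (\<lambda>\<omega>. matrix_inv (Sigh \<omega>) *v Gamh \<omega>)"
    and "V \<equiv> cov_mat M (\<lambda>\<omega>. (1 / real n) *\<^sub>R (\<Sum>i<n. (Y i \<omega> - X i \<omega> \<bullet> beta) *\<^sub>R X i \<omega>))"
    and "psi \<equiv> (\<lambda>i \<omega>. matrix_inv Sig *v ((Y i \<omega> - X i \<omega> \<bullet> beta) *\<^sub>R X i \<omega>))"
  defines "psibar \<equiv> (\<lambda>\<omega>. (1 / real n) *\<^sub>R (\<Sum>i<n. psi i \<omega>))"
    and "Om \<equiv> matrix_inv Sig ** V ** matrix_inv Sig"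
    and "D \<equiv> (\<lambda>\<omega>. op_norm (mat_sqrt (matrix_inv Sig) ** Sigh \<omega> ** mat_sqrt (matrix_inv Sig) - mat 1))"
  defines "Delta \<equiv> (SUP t\<in>{0::real..}.
              \<bar>measure M {\<omega> \<in> space M. (MAX j. \<bar>psibar \<omega> $ j / sqrt (Om $ j $ j)\<bar>) \<le> t}
               - measure N {x \<in> space N. (MAX j. \<bar>G x $ j\<bar>) \<le> t}\<bar>)"
    and "PhiAC \<equiv> (SUP p\<in>{(t::real, e::real). 0 \<le> t \<and> 0 < e}.
              ereal (measure N {x \<in> space N. fst p \<le> (MAX j. \<bar>G x $ j\<bar>)
                                  \<and> (MAX j. \<bar>G x $ j\<bar>) \<le> fst p + snd p} / snd p))"
    and "E \<equiv> {\<omega> \<in> space M. D \<omega> \<le> 1/2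
              \<and> D \<omega> * wnorm (Sig ** matrix_inv V ** Sig) (psibar \<omega>) \<le> eta
              \<and> (MAX j. \<bar>sqrt (Om $ j $ j / Omh \<omega> $ j $ j) - 1\<bar>) \<le> eta}"
    and "kappa \<equiv> cond_num (mat_sqrt (matrix_inv Sig) ** mat_sqrt V)"
  defines "Cn \<equiv> 2 * kappa + 2 * kappa * eta + sqrt (2 * ln (2 * real n))"
  assumes Sig_inv: "invertible Sig"
    and V_inv: "invertible V"
    and G_gauss: "centered_gaussian N G (corr_mat Om)"
  shows "ereal (SUP t\<in>{0::real..}.
           \<bar>measure M {\<omega> \<in> space M.
               (MAX j. \<bar>(betah \<omega> $ j - beta $ j) / sqrt (Omh \<omega> $ j $ j)\<bar>) \<le> t}
            - measure N {x \<in> space N. (MAX j. \<bar>G x $ j\<bar>) \<le> t}\<bar>)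
         \<le> ereal (2 * Delta + measure M (space M - E) + real CARD('d) / real n)
           + ereal (Cn * eta) * PhiAC"
proof -
  interpret M: prob_space M by (rule M)
  interpret N: prob_space N using G_gauss by (simp add: centered_gaussian_def)
  have [measurable]: "G \<in> borel_measurable N" using G_gauss by (simp add: centered_gaussian_def)
  note [measurable] = Omh_meas
  have Xc: "(\<lambda>\<omega>. X i \<omega> $ j) \<in> borel_measurable M" if "i < n" for i j
    using X_meas[OF that] by measurable
  define score where "score \<omega> = (1 / real n) *\<^sub>R (\<Sum>i<n. (Y i \<omega> - X i \<omega> \<bullet> beta) *\<^sub>R X i \<omega>)" for \<omega>
  have psibar_eq: "psibar \<omega> = matrix_inv Sig *v score \<omega>" for \<omega>
    by (simp add: psibar_def psi_def score_def matrix_vector_mult_scaleR linear_sum[OF matrix_vector_mul_linear])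
  \<comment> \<open>The averaged score is the residual of the empirical normal equations at
    \<open>beta\<close>; this links \<open>psibar\<close> to \<open>betah - beta\<close>.\<close>
  have score_eq: "score \<omega> = Gamh \<omega> - Sigh \<omega> *v beta" for \<omega>
    by (simp add: score_def Gamh_def Sigh_def sum_matrix_vector_mult outer_mult_vector
        scaleR_left_diff_distrib sum_subtractf scaleR_right_diff_distrib flip: scaleR_matrix_vector_assoc)

  have Sigh_meas[measurable]: "Sigh \<in> borel_measurable M"
    unfolding Sigh_def outer_def
    by (intro borel_measurable_vecI)
       (auto intro!: borel_measurable_divide borel_measurable_const borel_measurable_times borel_measurable_sum Xc)
  have Gamh_meas[measurable]: "Gamh \<in> borel_measurable M"
    unfolding Gamh_def
    by (intro borel_measurable_scaleR borel_measurable_const borel_measurable_sum) (auto intro: X_meas Y_meas)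
  have betah_meas[measurable]: "betah \<in> borel_measurable M"
    unfolding betah_def by (intro borel_measurable_matrix_inv_mult_vector) measurable
  have psibar_meas[measurable]: "psibar \<in> borel_measurable M"
    unfolding psibar_eq score_eq by measurable
  have D_meas[measurable]: "D \<in> borel_measurable M"
    unfolding D_def by measurable
  have E_meas[measurable]: "E \<in> sets M"
    unfolding E_def wnorm_def by measurable

  have Sig_psd: "mat_psd Sig"
    unfolding Sig_def by (intro mat_psd_scaleR mat_psd_sum mat_psd_mexp_outer X_meas X_L2) auto

  define f where "f \<omega> = (MAX j. \<bar>(betah \<omega> $ j - beta $ j) / sqrt (Omh \<omega> $ j $ j)\<bar>)" for \<omega>
  define h where "h \<omega> = (MAX j. \<bar>psibar \<omega> $ j / sqrt (Om $ j $ j)\<bar>)" for \<omega>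
  define g where "g x = (MAX j. \<bar>G x $ j\<bar>)" for x
  \<comment> \<open>Chosen so that the two-sided Gaussian bound
    \<open>2 * exp (- s\<^sup>2 / 2)\<close> equals \<open>1 / n\<close> for each
    coordinate.\<close>
  define s where "s = sqrt (2 * ln (2 * real n))"
  define C where "C = corr_mat Om"
  have fm[measurable]: "f \<in> borel_measurable M" unfolding f_def by measurable
  have hm[measurable]: "h \<in> borel_measurable M" unfolding h_def by measurable
  have gm[measurable]: "g \<in> borel_measurable N" unfolding g_def by measurable
  have h_ge: "\<bar>psibar \<omega> $ j / sqrt (Om $ j $ j)\<bar> \<le> h \<omega>" for j \<omega>
    unfolding h_def by (rule Max_ge) auto
  have g0: "0 \<le> g x" for x
  proof -
    have "\<bar>G x $ undefined\<bar> \<le> g x" unfolding g_def by (rule Max_ge) auto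
    then show ?thesis by linarith
  qed

  have ln_pos: "0 < ln (2 * real n)" using n_pos by simp
  have s: "0 < s" "s\<^sup>2 = 2 * ln (2 * real n)" using ln_pos by (simp_all add: s_def)
  have tail: "measure N {x \<in> space N. s < g x} \<le> real CARD('d) / real n"
  proof -
    have comp: "measure N {x \<in> space N. s < \<bar>G x $ j\<bar>} \<le> 1 / real n" for j
    proof -
      define e :: "real^'d" where "e = axis j 1"
      have "e \<bullet> (C *v e) = C $ j $ j"
        by (simp add: e_def inner_axis' matrix_vector_mult_basis column_def)
      then have "measure N {x \<in> space N. s < \<bar>e \<bullet> G x\<bar>} \<le> 2 * exp (- s\<^sup>2 / 2)"
        using s abs_corr_mat_diag[of Om j] by (intro centered_gaussian_tail[OF G_gauss]) (simp_all add: C_def)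
      also have "2 * exp (- s\<^sup>2 / 2) = 1 / real n"
        using n_pos by (simp add: s exp_minus inverse_eq_divide)
      finally show ?thesis by (simp add: e_def inner_axis')
    qed
    have "{x \<in> space N. s < g x} \<subseteq> (\<Union>j\<in>UNIV. {x \<in> space N. s < \<bar>G x $ j\<bar>})"
      unfolding g_def by (subst Max_gr_iff) auto
    then have "measure N {x \<in> space N. s < g x} \<le> measure N (\<Union>j\<in>UNIV. {x \<in> space N. s < \<bar>G x $ j\<bar>})"
      by (intro N.finite_measure_mono) auto
    also have "\<dots> \<le> (\<Sum>j\<in>UNIV. measure N {x \<in> space N. s < \<bar>G x $ j\<bar>})"
      by (intro measure_UNION_le) auto
    also have "\<dots> \<le> (\<Sum>j\<in>(UNIV::'d set). 1 / real n)"
      by (intro sum_mono comp)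
    finally show ?thesis by simp
  qed

  have kappa0: "0 \<le> kappa" by (simp add: kappa_def cond_num_def op_norm_nonneg)
  have Cn_s: "s \<le> Cn" using kappa0 eta_pos by (simp add: Cn_def s_def)
  have Cn_eta: "0 < Cn * eta" using Cn_s s eta_pos by (intro mult_pos_pos) auto

  have abs1: "\<bar>measure M A - measure N B\<bar> \<le> 1" for A B
    using M.prob_le_1[of A] N.prob_le_1[of B] measure_nonneg[of M A] measure_nonneg[of N B]
    by linarith
  \<comment> \<open>A real supremum dominates its members only if they are bounded above, here by
    \<open>1\<close>.\<close>
  have Delta_ge: "\<bar>measure M {\<omega> \<in> space M. h \<omega> \<le> u} - measure N {x \<in> space N. g x \<le> u}\<bar> \<le> Delta"
    if "0 \<le> u" for u
    unfolding Delta_def h_def g_def using that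
    by (intro cSUP_upper bdd_aboveI[where M = 1]) (auto simp: abs1)
  have Delta0: "0 \<le> Delta" using Delta_ge[of 0] by linarith
  have Phi_ge: "ereal (measure N {x \<in> space N. u \<le> g x \<and> g x \<le> u + e} / e) \<le> PhiAC"
    if "0 \<le> u" "0 < e" for u e
    unfolding PhiAC_def g_def using that by (intro SUP_upper2[of "(u, e)"]) auto

  have fin: "\<bar>measure M {\<omega> \<in> space M. f \<omega> \<le> t} - measure N {x \<in> space N. g x \<le> t}\<bar>
      \<le> 2 * Delta + measure M (space M - E) + real CARD('d) / real n + Cn * eta * phi"
    if phi: "PhiAC = ereal phi" and t: "0 \<le> t" for phi t
  proof -
    have K: "measure N {x \<in> space N. u \<le> g x \<and> g x \<le> u + e} \<le> e * phi" if "0 \<le> u" "0 < e" for u e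
      using Phi_ge[OF that] that by (simp add: phi field_simps)
    have phi0: "0 \<le> phi"
      using K[of 0 1] measure_nonneg[of N "{x \<in> space N. 0 \<le> g x \<and> g x \<le> 0 + 1}"] by linarith
    have P0: "0 \<le> measure M (space M - E)" by simp
    consider "1 \<le> eta" | "E = {}" | "eta < 1" "E \<noteq> {}" by (meson not_le)
    then show ?thesis
    proof cases
      \<comment> \<open>the Gaussian tail alone makes the right-hand side at least \<open>1\<close>: the mass of \<open>[0, s]\<close> is at
        least \<open>1 - d / n\<close> and at most \<open>s \<Phi>\<close>, and \<open>s \<le> C \<eta>\<close>\<close>
      case 1
      have eq: "{x \<in> space N. \<not> s < g x} = {x \<in> space N. 0 \<le> g x \<and> g x \<le> 0 + s}" using g0 by auto
      have "measure N {x \<in> space N. \<not> s < g x} = 1 - measure N {x \<in> space N. s < g x}"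
        by (rule N.prob_neg) measurable
      then have "1 - real CARD('d) / real n \<le> s * phi"
        unfolding eq using tail K[of 0 s, OF order_refl s(1)] by linarith
      also have "s * phi \<le> Cn * eta * phi"
      proof (rule mult_right_mono[OF _ phi0])
        have "s * 1 \<le> Cn * eta"
          by (rule mult_mono[OF Cn_s 1]) (use Cn_s s(1) in linarith)+
        then show "s \<le> Cn * eta" by simp
      qed
      finally show ?thesis using abs1[of "{\<omega> \<in> space M. f \<omega> \<le> t}" "{x \<in> space N. g x \<le> t}"] Delta0 P0
        by linarith
    next
      case 2
      have "0 \<le> Cn * eta * phi" using Cn_eta phi0 by simp
      moreover have "0 \<le> real CARD('d) / real n" by simp
      moreover have "measure M (space M - E) = 1" using 2 by (simp add: M.prob_space)
      ultimately show ?thesis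
        using abs1[of "{\<omega> \<in> space M. f \<omega> \<le> t}" "{x \<in> space N. g x \<le> t}"] Delta0 by linarith
    next
      case 3
      have E_ratio: "\<bar>sqrt (Om $ j $ j / Omh \<omega> $ j $ j) - 1\<bar> \<le> eta" if "\<omega> \<in> E" for \<omega> j
      proof -
        have "\<bar>sqrt (Om $ j $ j / Omh \<omega> $ j $ j) - 1\<bar> \<le> (MAX j. \<bar>sqrt (Om $ j $ j / Omh \<omega> $ j $ j) - 1\<bar>)"
          by (rule Max_ge) auto
        then show ?thesis using that by (simp add: E_def)
      qed
      obtain \<omega>0 where \<omega>0: "\<omega>0 \<in> E" using 3 by blast
      have Om_pos: "0 < Om $ j $ j" for j
      proof -
        \<comment> \<open>A point of \<open>E\<close> keeps the root within \<open>eta < 1\<close>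
          of \<open>1\<close>, hence positive; as \<open>sqrt\<close> preserves signs, the ratio and
          then \<open>Om $ j $ j\<close> are positive.\<close>
        have "0 < sqrt (Om $ j $ j / Omh \<omega>0 $ j $ j)"
          using E_ratio[OF \<omega>0, of j] 3 by linarith
        then show ?thesis
          using Omh_diag[of \<omega>0 j] \<omega>0 by (simp add: E_def zero_less_divide_iff)
      qed
      \<comment> \<open>Some direction with positive form is needed to fix the sign of
        \<open>C\<close>; any coordinate axis serves, since its correlation entry is
        \<open>1\<close>.\<close>
      have C1: "0 < axis (undefined::'d) 1 \<bullet> (C *v axis undefined 1)"
        using Om_pos[of undefined]
        by (simp add: inner_axis' matrix_vector_mult_basis column_def C_def corr_mat_def)
      have Om_nonneg: "0 \<le> y \<bullet> (Om *v y)" for y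
        unfolding corr_mat_quadratic_form[OF Om_pos, symmetric]
        using centered_gaussian_quadratic_form_nonneg[OF G_gauss] C1 by (simp add: C_def)
      \<comment> \<open>not automatic: \<open>V\<close> is a genuine covariance only if the scores are square integrable, which is not assumed\<close>
      have V_psd: "mat_psd V"
      proof -
        have "0 \<le> x \<bullet> (V *v x)" for x
        proof -
          \<comment> \<open>Conjugating the sandwich matrix \<open>Om\<close> by \<open>Sig\<close>
            recovers \<open>V\<close>.\<close>
          have "(Sig *v x) \<bullet> (Om *v (Sig *v x)) = x \<bullet> (V *v x)"
            using Sig_psd
            by (simp add: Om_def mat_psd_def mat_symmetric_def inner_matrix_symmetric
                matrix_inv_mult_vector[OF Sig_inv] flip: matrix_vector_mul_assoc)
          then show ?thesis using Om_nonneg[of "Sig *v x"] by simp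
        qed
        then show ?thesis
          unfolding mat_psd_def by (simp add: V_def mat_symmetric_cov_mat)
      qed
      have close: "\<bar>f \<omega> - h \<omega>\<bar> \<le> Cn * eta" if \<omega>: "\<omega> \<in> E" and hs: "h \<omega> \<le> s" for \<omega>
        unfolding f_def h_def
      proof (rule Max_abs_diff_le)
        fix j
        define p where "p = betah \<omega> - beta"
        define z where "z = psibar \<omega>"
        define b where "b = sqrt (Om $ j $ j)"
        define r where "r = sqrt (Om $ j $ j / Omh \<omega> $ j $ j)"
        have b: "0 < b" using Om_pos by (simp add: b_def)
        have D: "op_norm (mat_sqrt (matrix_inv Sig) ** Sigh \<omega> ** mat_sqrt (matrix_inv Sig) - mat 1) \<le> 1/2"
          using \<omega> by (simp add: E_def D_def)
        have "mat_psd (matrix_inv Sig)" by (rule mat_psd_matrix_inv[OF Sig_psd Sig_inv])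
        then have RR: "mat_sqrt (matrix_inv Sig) ** mat_sqrt (matrix_inv Sig) = matrix_inv Sig"
          by (rule mat_sqrt_square)
        \<comment> \<open>On \<open>E\<close> the empirical matrix is invertible, so
          \<open>betah\<close> really solves the normal equations there.\<close>
        have "invertible (matrix_inv Sig)"
          unfolding invertible_def using matrix_inv_mult[OF Sig_inv] by blast
        then have "invertible (mat_sqrt (matrix_inv Sig))"
          by (intro invertible_of_square[of "mat_sqrt (matrix_inv Sig)"]) (simp add: RR)
        then have iSigh: "invertible (Sigh \<omega>)"
          by (rule invertible_of_perturbed_identity[OF _ D])
        have "Sigh \<omega> *v p = Sig *v z"
          by (simp add: p_def z_def betah_def psibar_eq score_eq matrix_vector_mult_diff_distrib
              matrix_inv_mult_vector[OF iSigh] matrix_inv_mult_vector[OF Sig_inv])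
        from component_error_le[OF Sig_psd Sig_inv V_psd V_inv D this, of j]
        have "\<bar>p $ j - z $ j\<bar> \<le> 2 * kappa * (D \<omega> * wnorm (Sig ** matrix_inv V ** Sig) z) * b"
          by (simp add: kappa_def D_def b_def Om_def)
        also have "\<dots> \<le> 2 * kappa * eta * b"
          using \<omega> kappa0 b by (intro mult_right_mono mult_left_mono) (auto simp: E_def z_def)
        finally have 1: "\<bar>(p $ j - z $ j) / b\<bar> \<le> 2 * kappa * eta"
          using b by (simp add: abs_divide divide_le_eq)
        have r: "\<bar>r - 1\<bar> \<le> eta" using E_ratio[OF \<omega>] by (simp add: r_def)
        then have r1: "\<bar>r\<bar> \<le> 1 + eta" by linarith
        have zs: "\<bar>z $ j / b\<bar> \<le> s" using h_ge[of \<omega> j] hs by (simp add: z_def b_def)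
        have oh: "0 < sqrt (Omh \<omega> $ j $ j)" using Omh_diag \<omega> by (simp add: E_def)
        \<comment> \<open>Splits the error into linearisation, rescaled by \<open>r\<close>, and
          studentisation, where \<open>r - 1\<close> multiplies the oracle statistic bounded by
          \<open>s\<close>.\<close>
        have "p $ j / sqrt (Omh \<omega> $ j $ j) - z $ j / b = r * ((p $ j - z $ j) / b) + (r - 1) * (z $ j / b)"
          using b oh by (simp add: r_def real_sqrt_divide b_def[symmetric] field_simps)
        then have "\<bar>p $ j / sqrt (Omh \<omega> $ j $ j) - z $ j / b\<bar> \<le> \<bar>r\<bar> * \<bar>(p $ j - z $ j) / b\<bar> + \<bar>r - 1\<bar> * \<bar>z $ j / b\<bar>"
          by (metis abs_mult abs_triangle_ineq)
        also have "\<dots> \<le> (1 + eta) * (2 * kappa * eta) + eta * s"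
          using 1 r r1 zs eta_pos by (intro add_mono mult_mono) auto
        also have "\<dots> = Cn * eta" by (simp add: Cn_def s_def algebra_simps)
        finally show "\<bar>(betah \<omega> $ j - beta $ j) / sqrt (Omh \<omega> $ j $ j) - psibar \<omega> $ j / sqrt (Om $ j $ j)\<bar> \<le> Cn * eta"
          by (simp add: p_def z_def b_def)
      qed
      \<comment> \<open>The shift is \<open>Cn * eta\<close>; an interval of that length has
        Gaussian maximum mass at most \<open>Cn * eta * phi\<close>.\<close>
      show ?thesis
        by (rule kolmogorov_distance_perturbation[OF M N.prob_space_axioms fm hm gm E_meas close g0 _ _ tail Delta_ge K t])
           (use s Cn_eta in auto)
    qed
  qed

  have "ereal (SUP t\<in>{0::real..}. \<bar>measure M {\<omega> \<in> space M. f \<omega> \<le> t} - measure N {x \<in> space N. g x \<le> t}\<bar>)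
     \<le> ereal (2 * Delta + measure M (space M - E) + real CARD('d) / real n) + ereal (Cn * eta) * PhiAC"
  proof (cases PhiAC)
    case (real phi)
    have "(SUP t\<in>{0::real..}. \<bar>measure M {\<omega> \<in> space M. f \<omega> \<le> t} - measure N {x \<in> space N. g x \<le> t}\<bar>)
      \<le> 2 * Delta + measure M (space M - E) + real CARD('d) / real n + Cn * eta * phi"
      using fin[OF real] by (intro cSUP_least) auto
    then show ?thesis by (simp add: real)
  next
    \<comment> \<open>Strict positivity of \<open>Cn * eta\<close> matters: in the extended reals
      \<open>0 * \<infinity> = 0\<close>.\<close>
    case PInf
    then have "ereal (Cn * eta) * PhiAC = \<infinity>" using Cn_eta by auto
    show ?thesis unfolding \<open>ereal (Cn * eta) * PhiAC = \<infinity>\<close> by simp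
  next
    case MInf
    then show ?thesis using Phi_ge[of 0 1] by simp
  qed
  then show ?thesis unfolding f_def g_def .
qed

end
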